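(* Let $G$ be a directed graph on $[n]$ with $1$-transversal number $\tau_1$. Then \[ \lambda_M(G)\ \le\ n+\sum_{i=1}^{\tau_1}\lambda(i-1,\,n-\tau_1)\ \le\ \left(\frac{\tau_1^2}{2}+\frac{3\tau_1}{2}+1\right)n . \]
   Context: Graphs are directed and may contain loops. Write $[n]=\{1,\dots,n\}$. A $1$-feedback vertex set of $G$ is a set $I$ of vertices such that all cycles of the graph $G\setminus I$ (obtained by deleting $I$) are loops (cycles of length one); the $1$-transversal number of $G$ is the minimum size of a $1$-feedback vertex set. For integers $i\ge 0$, $\alpha\ge 0$, a word on $[\alpha+i]$ is $(i,\alpha)$-complete if it contains, as (not necessarily contiguous) subsequences, all permutations $j_1,\dots,j_{\alpha+i}$ of $[\alpha+i]$ such that for all $1\le\ell<\alpha+i$, if $j_\ell,j_{\ell+1}\in[\alpha]$ then $j_\ell<j_{\ell+1}$; $\lambda(i,\alpha)$ is the length of a shortest $(i,\alpha)$-complete word. An $n$-component (Boolean) network is a function $f=(f_1,\dots,f_n):\{0,1\}^n\to\{0,1\}^n$; its interaction graph is the directed graph on $[n]$ with an edge from $j$ to $i$ iff there exist $x,y$ differing only in component $j$ with $f_i(x)\ne f_i(y)$. It is monotone if $x\le y$ (componentwise) implies $f(x)\le f(y)$. For $i\in[n]$, $f^i(x):=(x_1,\dots,x_{i-1},f_i(x),x_{i+1},\dots,x_n)$, and for a word $w=i_1\dots i_k$ over $[n]$, $f^w:=f^{i_k}\circ\cdots\circ f^{i_1}$ (identity for the empty word). A word $w$ fixes $f$ if $f^w(x)$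 is a fixed point of $f$ for every $x$. $\lambda_M(G)$ is the minimum length of a single word over $[n]$ fixing every $n$-component monotone network whose interaction graph is a subgraph of $G$. *)

theory Defs
  imports
    Complex_Main
    "HOL-Library.FuncSet"
    "HOL-Library.Sublist"
    "HOL-Library.Extended_Nat"
    "HOL-Combinatorics.Multiset_Permutations"
    "Graph_Theory.Graph_Theory"
begin

text \<open>
  A directed graph (loops allowed, no parallel arcs) is a \<open>pair_pre_digraph\<close>; \<open>with_proj\<close> turns
  it into the general digraphs for which cycles and subgraphs are defined. There, a cycle is a
  nonempty closed walk without repeated vertices, given by its list of arcs, so that the loops are
  exactly the cycles of length 1.
\<close>

definition one_feedback_vertex_set :: "'a pair_pre_digraph \<Rightarrow> 'a set \<Rightarrow> bool" where
  "one_feedback_vertex_set G I \<longleftrightarrow>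
     I \<subseteq> pverts G \<and>
     (\<forall>p. pre_digraph.cycle (with_proj G \<restriction> (pverts G - I)) p \<longrightarrow> length p = 1)"

definition one_transversal_number :: "'a pair_pre_digraph \<Rightarrow> nat" where
  "one_transversal_number G = (LEAST k. \<exists>I. one_feedback_vertex_set G I \<and> card I = k)"

lemma one_feedback_vertex_set_pverts: "one_feedback_vertex_set G (pverts G)"
  by (auto simp: one_feedback_vertex_set_def pre_digraph.cycle_def pre_digraph.awalk_def)


definition complete_word :: "nat \<Rightarrow> nat \<Rightarrow> nat list \<Rightarrow> bool" where
  "complete_word i \<alpha> w \<longleftrightarrow>
     set w \<subseteq> {1..\<alpha> + i} \<and>
     (\<forall>js \<in> permutations_of_set {1..\<alpha> + i}.
        (\<forall>l. Suc l < length js \<longrightarrow> js ! l \<in> {1..\<alpha>} \<longrightarrow> js ! Suc l \<in> {1..\<alpha>} \<longrightarrow>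
             js ! l < js ! Suc l) \<longrightarrow>
        subseq js w)"

definition lambda_complete :: "nat \<Rightarrow> nat \<Rightarrow> nat" where
  "lambda_complete i \<alpha> = (LEAST k. \<exists>w. complete_word i \<alpha> w \<and> length w = k)"

lemma ex_complete_word: "\<exists>w. complete_word i \<alpha> w"
proof -
  let ?P = "permutations_of_set {1..\<alpha> + i}"
  have sub: "js \<in> set L \<Longrightarrow> subseq js (concat L)" for js :: "nat list" and L
    by (induction L) (auto intro: subseq_order.order_trans)
  obtain L where "set L = ?P"
    using finite_list[of ?P] by auto
  then have "complete_word i \<alpha> (concat L)"
    using sub by (auto simp: complete_word_def permutations_of_set_def)
  then show ?thesis ..
qed


text \<open>
  The set \<open>{0,1}\<^sup>n\<close>, with components indexed by \<open>{1..n}\<close>. States are \<open>undefined\<close> outside of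
  \<open>{1..n}\<close>, so that equality and the pointwise order on functions are the componentwise ones.
\<close>

definition states :: "nat \<Rightarrow> (nat \<Rightarrow> bool) set" where
  "states n = {1..n} \<rightarrow>\<^sub>E UNIV"

definition network :: "nat \<Rightarrow> ((nat \<Rightarrow> bool) \<Rightarrow> nat \<Rightarrow> bool) \<Rightarrow> bool" where
  "network n f \<longleftrightarrow> f \<in> states n \<rightarrow> states n"

definition monotone_network :: "nat \<Rightarrow> ((nat \<Rightarrow> bool) \<Rightarrow> nat \<Rightarrow> bool) \<Rightarrow> bool" where
  "monotone_network n f \<longleftrightarrow> network n f \<and> mono_on (states n) f"

definition interaction_graph :: "nat \<Rightarrow> ((nat \<Rightarrow> bool) \<Rightarrow> nat \<Rightarrow> bool) \<Rightarrow> nat pair_pre_digraph" where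
  "interaction_graph n f =
     \<lparr> pverts = {1..n},
       parcs = {(j, i). j \<in> {1..n} \<and> i \<in> {1..n} \<and>
         (\<exists>x \<in> states n. \<exists>y \<in> states n. x j \<noteq> y j \<and> (\<forall>k. k \<noteq> j \<longrightarrow> x k = y k) \<and> f x i \<noteq> f y i)} \<rparr>"

definition update_component ::
    "((nat \<Rightarrow> bool) \<Rightarrow> nat \<Rightarrow> bool) \<Rightarrow> nat \<Rightarrow> (nat \<Rightarrow> bool) \<Rightarrow> nat \<Rightarrow> bool" where
  "update_component f i x = x(i := f x i)"

text \<open>The first letter of the word is applied first.\<close>

definition update_word ::
    "((nat \<Rightarrow> bool) \<Rightarrow> nat \<Rightarrow> bool) \<Rightarrow> nat list \<Rightarrow> (nat \<Rightarrow> bool) \<Rightarrow> nat \<Rightarrow> bool" where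
  "update_word f w = fold (update_component f) w"

definition fixes_network :: "nat \<Rightarrow> ((nat \<Rightarrow> bool) \<Rightarrow> nat \<Rightarrow> bool) \<Rightarrow> nat list \<Rightarrow> bool" where
  "fixes_network n f w \<longleftrightarrow> (\<forall>x \<in> states n. f (update_word f w x) = update_word f w x)"

text \<open>
  The minimal length is taken in \<open>enat\<close>, where the infimum of the empty set is \<open>\<infinity>\<close>: an upper bound
  on \<open>lambda_M n G\<close> includes the existence of a word fixing all the networks in question.
\<close>

definition lambda_M :: "nat \<Rightarrow> nat pair_pre_digraph \<Rightarrow> enat" where
  "lambda_M n G =
     (INF w \<in> {w. set w \<subseteq> {1..n} \<and>
        (\<forall>f. monotone_network n f \<and> subgraph (with_proj (interaction_graph n f)) (with_proj G)
             \<longrightarrow> fixes_network n f w)}.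
        enat (length w))"

end

theory Submission
  imports Defs
begin

text \<open>
  Order the \<open>\<alpha> = n - \<tau>\<close> vertices outside a minimum 1-feedback vertex set topologically; since their
  only cycles are loops and the network is monotone, one sweep in this order stabilizes them. Then
  add the remaining \<open>\<tau>\<close> vertices one at a time: if the components in \<open>S\<close> are stable and a new
  component \<open>c\<close> is updated, then either everything in \<open>S \<union> {c}\<close> is stable, or by monotonicity all
  further changes in \<open>S\<close> go in the direction of the change of \<open>c\<close>. In the latter case each component
  changes at most once, and the changes can be made in an order which is contained in every complete
  word; a monotone trajectory is not disturbed by additional updates.
\<close>

section \<open>Feedback vertex sets and topological orders\<close>

text \<open>Delete all loops to obtain \<open>H\<close>. A closed walk in \<open>H\<close> contains
  a cycle, which is also a cycle of \<open>G\<close> and so has length 1; but then it is a loop, and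
  \<open>H\<close> has none.\<close>

lemma (in wf_digraph) acyclic_arcs_ends_minus_Id:
  assumes "\<And>p. cycle p \<Longrightarrow> length p = 1"
  shows "acyclic (arcs_ends G - Id)"
proof (rule acyclicI, safe)
  define H where "H = G\<lparr>arcs := {e \<in> arcs G. tail G e \<noteq> head G e}\<rparr>"
  have ends: "arcs_ends H = arcs_ends G - Id"
    by (auto simp: H_def arcs_ends_def arc_to_ends_def)
  interpret H: wf_digraph H
    by unfold_locales (auto simp: H_def)
  have sub: "subgraph H G"
    using wf_digraph_axioms H.wf_digraph_axioms
    by (auto simp: subgraph_def compatible_def H_def)
  fix u
  assume "(u, u) \<in> (arcs_ends G - Id)\<^sup>+"
  then obtain p where "H.awalk u p u" "p \<noteq> []"
    unfolding ends[symmetric] H.reachable1_awalk by auto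
  then obtain q where q: "H.cycle q"
    using H.closed_w_imp_cycle[of p] by (auto simp: H.closed_w_def)
  then have "length q = 1"
    using assms subgraph_cycle[OF sub] by blast
  then obtain e where "q = [e]"
    by (auto simp: length_Suc_conv)
  with q obtain v where "H.awalk v [e] v"
    by (auto simp: H.cycle_def)
  then have "e \<in> arcs H" "tail H e = head H e"
    by (auto simp: H.awalk_simps)
  then show False
    by (simp add: H_def)
qed

text \<open>A finite acyclic relation is well-founded, so a minimal element can be put in front and
  the rest ordered recursively.\<close>

lemma ex_topological_order:
  assumes "finite A" "finite R" "acyclic R"
  shows "\<exists>L. distinct L \<and> set L = A \<and> sorted_wrt (\<lambda>a b. (b, a) \<notin> R) L"
  using \<open>finite A\<close>
proof (induction A rule: finite_psubset_induct)
  case (psubset A)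
  show ?case
  proof (cases "A = {}")
    case False
    have "wf R"
      using assms finite_acyclic_wf by blast
    then obtain m where m: "m \<in> A" "\<And>y. (y, m) \<in> R \<Longrightarrow> y \<notin> A"
      using False wfE_min[of R] by (metis all_not_in_conv)
    obtain L where L: "distinct L" "set L = A - {m}" "sorted_wrt (\<lambda>a b. (b, a) \<notin> R) L"
      using psubset.IH[of "A - {m}"] m(1) by blast
    have "distinct (m # L) \<and> set (m # L) = A \<and> sorted_wrt (\<lambda>a b. (b, a) \<notin> R) (m # L)"
      using L m by auto
    then show ?thesis ..
  qed auto
qed

text \<open>The vertices outside \<open>I\<close> receive the first positions, in topological order,
  and those of \<open>I\<close> follow in any order. Thus the letters that complete words treat as
  ordered stand for the vertices outside \<open>I\<close>.\<close>

lemma feedback_vertex_set_ordering: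
  assumes "pair_wf_digraph G" "pverts G = {1..n}" "one_feedback_vertex_set G I"
  obtains \<sigma> where "\<sigma> permutes {1..n}"
    and "\<And>a b. 1 \<le> a \<Longrightarrow> a < b \<Longrightarrow> b \<le> n - card I \<Longrightarrow> (\<sigma> b, \<sigma> a) \<notin> parcs G"
proof -
  interpret pair_wf_digraph G by fact
  define A where "A = pverts G - I"
  define K where "K = with_proj G \<restriction> A"
  have I: "I \<subseteq> {1..n}" and K1: "\<And>p. pre_digraph.cycle K p \<Longrightarrow> length p = 1"
    using assms by (auto simp: one_feedback_vertex_set_def K_def A_def)
  have wfK: "wf_digraph K"
    unfolding K_def by (rule wellformed_induce_subgraph)
  have K: "arcs_ends K = {e \<in> parcs G. fst e \<in> A \<and> snd e \<in> A}"
    by (auto simp: K_def arcs_ends_conv image_iff)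
  have "finite (pverts G \<times> pverts G)"
    using assms(2) by simp
  moreover have "parcs G \<subseteq> pverts G \<times> pverts G"
    using in_arcsD1 in_arcsD2 by auto
  ultimately have "finite (parcs G)"
    using finite_subset by blast
  then have fin: "finite (arcs_ends K - Id)"
    by (simp add: K)
  have "finite A"
    using assms(2) by (simp add: A_def)
  from ex_topological_order[OF this fin wf_digraph.acyclic_arcs_ends_minus_Id[OF wfK K1]]
  obtain L where L: "distinct L" "set L = A" "sorted_wrt (\<lambda>a b. (b, a) \<notin> arcs_ends K - Id) L"
    by blast
  obtain L' where L': "distinct L'" "set L' = I"
    using I finite_distinct_list[of I] finite_subset by blast
  define M where "M = L @ L'"
  have M: "distinct M" "set M = {1..n}"
    using L L' I assms(2) by (auto simp: M_def A_def)
  have len: "length M = n"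
    using distinct_card[OF M(1)] M(2) by simp
  have cardL: "length L = n - card I"
    using len distinct_card[OF L'(1)] L'(2) by (simp add: M_def)
  \<comment> \<open>Vertices count from 1 and list positions from 0. Outside \<open>{1..n}\<close>
    the map must be the identity to be a permutation in the sense of
    \<open>permutes\<close>.\<close>
  define \<sigma> where "\<sigma> a = (if a \<in> {1..n} then M ! (a - 1) else a)" for a
  have "inj_on \<sigma> {1..n}"
    using M(1) len by (auto simp: inj_on_def \<sigma>_def nth_eq_iff_index_eq)
  moreover have "\<sigma> ` {1..n} \<subseteq> {1..n}"
  proof (rule image_subsetI)
    fix a
    assume a: "a \<in> {1..n}"
    then have "M ! (a - 1) \<in> set M"
      using len by (intro nth_mem) auto
    then show "\<sigma> a \<in> {1..n}"
      using a M(2) by (simp add: \<sigma>_def)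
  qed
  ultimately have "bij_betw \<sigma> {1..n} {1..n}"
    using endo_inj_surj[of "{1..n}" \<sigma>] by (auto simp: bij_betw_def)
  then have "\<sigma> permutes {1..n}"
    by (rule bij_imp_permutes) (auto simp: \<sigma>_def)
  moreover have "(\<sigma> b, \<sigma> a) \<notin> parcs G" if "1 \<le> a" "a < b" "b \<le> n - card I" for a b
  proof -
    have ab: "a - 1 < b - 1" "b - 1 < length L"
      using that cardL by auto
    then have "\<sigma> a = L ! (a - 1)" "\<sigma> b = L ! (b - 1)"
      using that by (auto simp: \<sigma>_def M_def nth_append)
    moreover have "(L ! (b - 1), L ! (a - 1)) \<notin> arcs_ends K - Id"
      using sorted_wrt_nth_less[OF L(3) ab] .
    moreover have "L ! (b - 1) \<noteq> L ! (a - 1)"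
      using ab L(1) by (simp add: nth_eq_iff_index_eq)
    moreover have "L ! (b - 1) \<in> A" "L ! (a - 1) \<in> A"
      using ab L(2) nth_mem[of "b - 1" L] nth_mem[of "a - 1" L] by auto
    ultimately show ?thesis
      by (auto simp: K)
  qed
  ultimately show thesis
    using that by blast
qed


section \<open>Complete words\<close>

text \<open>The condition from \<open>complete_word\<close>, here for arbitrary words and in a form
  that splits along append and cons.\<close>

definition admissible :: "nat \<Rightarrow> nat list \<Rightarrow> bool" where
  "admissible \<alpha> = successively (\<lambda>a b. a \<in> {1..\<alpha>} \<longrightarrow> b \<in> {1..\<alpha>} \<longrightarrow> a < b)"

lemma complete_word_alt:
  "complete_word i \<alpha> w \<longleftrightarrow>
     set w \<subseteq> {1..\<alpha> + i} \<and>
     (\<forall>js \<in> permutations_of_set {1..\<alpha> + i}. admissible \<alpha> js \<longrightarrow> subseq js w)"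
  by (simp only: complete_word_def admissible_def successively_conv_nth)

text \<open>Insert \<open>a\<close> after the longest prefix of letters of
  \<open>{1..\<alpha>}\<close> below \<open>a\<close>: the letter before it is smaller, and the
  letter after it is larger or lies outside \<open>{1..\<alpha>}\<close>.\<close>

lemma admissible_insert:
  assumes "admissible \<alpha> js" "distinct js" "a \<notin> set js"
  shows "\<exists>js'. admissible \<alpha> js' \<and> distinct js' \<and> set js' = insert a (set js) \<and> subseq js js'"
proof -
  let ?P = "\<lambda>x. x \<in> {1..\<alpha>} \<and> x < a"
  define us where "us = takeWhile ?P js"
  define vs where "vs = dropWhile ?P js"
  have js: "js = us @ vs"
    by (simp add: us_def vs_def)
  have "admissible \<alpha> (us @ a # vs)"
  proof -
    have "last us < a" if "us \<noteq> []"
      using last_in_set[OF that] set_takeWhileD[of _ ?P js] unfolding us_def by blast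
    moreover have "a < hd vs" if "vs \<noteq> []" "hd vs \<in> {1..\<alpha>}"
    proof -
      have "\<not> hd vs < a"
        using hd_dropWhile[of ?P js] that by (simp add: vs_def)
      moreover have "hd vs \<noteq> a"
        using that(1) assms(3) js by (metis hd_in_set Un_iff set_append)
      ultimately show ?thesis
        by simp
    qed
    ultimately show ?thesis
      using assms(1) unfolding js admissible_def
      by (cases vs) (auto simp: successively_append_iff successively_Cons)
  qed
  moreover have "distinct (us @ a # vs) \<and> set (us @ a # vs) = insert a (set js)"
    using assms(2,3) unfolding js by auto
  moreover have "subseq js (us @ a # vs)"
    unfolding js by (intro list_emb_append_mono) auto
  ultimately show ?thesis
    by blast
qed

text \<open>Completeness speaks of full permutations only. A partial one is extended by its missing
  letters, one at a time, with \<open>admissible_insert\<close>.\<close>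

lemma complete_word_subseq:
  assumes "complete_word i \<alpha> w" "admissible \<alpha> js" "distinct js" "set js \<subseteq> {1..\<alpha> + i}"
  shows "subseq js w"
  using assms(2-)
proof (induction "card ({1..\<alpha> + i} - set js)" arbitrary: js rule: less_induct)
  case less
  show ?case
  proof (cases "set js = {1..\<alpha> + i}")
    case True
    then show ?thesis
      using less.prems assms(1) by (auto simp: complete_word_alt permutations_of_set_def)
  next
    case False
    then obtain a where a: "a \<in> {1..\<alpha> + i} - set js"
      using less.prems by blast
    then obtain js' where js': "admissible \<alpha> js'" "distinct js'"
        "set js' = insert a (set js)" "subseq js js'"
      using admissible_insert[OF less.prems(1,2)] by blast
    have "card ({1..\<alpha> + i} - set js') < card ({1..\<alpha> + i} - set js)"
      using a js'(3) by (intro psubset_card_mono) auto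
    then have "subseq js' w"
      using less.hyps[of js'] js' a less.prems by auto
    then show ?thesis
      using js'(4) subseq_order.order_trans by blast
  qed
qed

lemma subseq_upt_if_sorted:
  assumes "sorted_wrt (<) js" "set js \<subseteq> {1..m}"
  shows "subseq js [1..<Suc m]"
proof -
  have "js = filter (\<lambda>a. a \<in> set js) [1..<Suc m]"
    using assms by (intro sorted_distinct_set_unique)
      (auto simp: strict_sorted_iff sorted_wrt_filter simp del: upt_Suc)
  then show ?thesis
    by (metis subseq_filter_left)
qed

text \<open>Cut \<open>js\<close> after each letter above \<alpha>. Every block is increasing and
  fits into one sweep over \<open>{1..m}\<close>; what remains after the last cut is increasing
  within \<open>{1..\<alpha>}\<close>.\<close>

lemma admissible_subseq_power:
  assumes "admissible \<alpha> js" "set js \<subseteq> {1..m}" "length (filter (\<lambda>a. \<alpha> < a) js) \<le> k" "\<alpha> \<le> m"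
  shows "subseq js (concat (replicate k [1..<Suc m]) @ [1..<Suc \<alpha>])"
  using assms(1-3)
proof (induction k arbitrary: js)
  case (Suc k)
  let ?P = "\<lambda>a. a \<le> \<alpha>"
  define us where "us = takeWhile ?P js"
  have us: "set us \<subseteq> {1..\<alpha>}"
    using Suc.prems(2) set_takeWhileD[of _ ?P js] by (force simp: us_def)
  have "successively (\<lambda>a b. a \<in> {1..\<alpha>} \<longrightarrow> b \<in> {1..\<alpha>} \<longrightarrow> a < b) us"
    using Suc.prems(1) successively_append_iff[of _ us "dropWhile ?P js"]
    by (simp add: us_def admissible_def)
  then have "successively (<) us"
    by (rule successively_mono) (use us in auto)
  then have sus: "sorted_wrt (<) us"
    by (simp add: successively_conv_sorted_wrt)
  show ?case
  proof (cases "dropWhile ?P js")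
    case Nil
    then have "us = js"
      using takeWhile_dropWhile_id[of ?P js] by (simp add: us_def)
    then have "subseq js [1..<Suc \<alpha>]"
      using subseq_upt_if_sorted[OF sus us] by simp
    then show ?thesis
      by (rule list_emb_append2)
  next
    case (Cons c rest)
    then have js: "js = us @ c # rest"
      using takeWhile_dropWhile_id[of ?P js] by (simp add: us_def)
    have c: "\<alpha> < c"
      using Cons hd_dropWhile[of ?P js] by auto
    have "sorted_wrt (<) (us @ [c])"
      using sus us c by (fastforce simp: sorted_wrt_append)
    moreover have "set (us @ [c]) \<subseteq> {1..m}"
      using Suc.prems(2) js by auto
    ultimately have "subseq (us @ [c]) [1..<Suc m]"
      by (rule subseq_upt_if_sorted)
    moreover have "subseq rest (concat (replicate k [1..<Suc m]) @ [1..<Suc \<alpha>])"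
      using Suc.prems c unfolding js
      by (intro Suc.IH) (auto simp: admissible_def successively_append_iff successively_Cons)
    ultimately have "subseq ((us @ [c]) @ rest)
        ([1..<Suc m] @ concat (replicate k [1..<Suc m]) @ [1..<Suc \<alpha>])"
      by (rule list_emb_append_mono)
    then show ?thesis
      by (simp add: js)
  qed
next
  case 0
  then have js: "set js \<subseteq> {1..\<alpha>}"
    by (auto simp: filter_empty_conv not_less)
  have "successively (<) js"
    using 0(1) unfolding admissible_def by (rule successively_mono) (use js in auto)
  then have "sorted_wrt (<) js"
    by (simp add: successively_conv_sorted_wrt)
  then show ?case
    using subseq_upt_if_sorted[OF _ js] by simp
qed

text \<open>A permutation of \<open>{1..\<alpha> + i}\<close> has exactly \<open>i\<close> letters
  above \<alpha>, so \<open>i\<close> full sweeps suffice. The length of this word bounds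
  \<open>lambda_complete\<close>.\<close>

lemma complete_word_power:
  "complete_word i \<alpha> (concat (replicate i [1..<Suc (\<alpha> + i)]) @ [1..<Suc \<alpha>])"
  unfolding complete_word_alt
proof (intro conjI ballI impI)
  fix js
  assume js: "js \<in> permutations_of_set {1..\<alpha> + i}" and adm: "admissible \<alpha> js"
  have "length (filter (\<lambda>a. \<alpha> < a) js) = card (set (filter (\<lambda>a. \<alpha> < a) js))"
    using js by (subst distinct_card) (auto simp: permutations_of_set_def)
  also have "set (filter (\<lambda>a. \<alpha> < a) js) = {\<alpha><..\<alpha> + i}"
    using js by (auto simp: permutations_of_set_def)
  finally have "length (filter (\<lambda>a. \<alpha> < a) js) \<le> i"
    by simp
  then show "subseq js (concat (replicate i [1..<Suc (\<alpha> + i)]) @ [1..<Suc \<alpha>])"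
    using js by (intro admissible_subseq_power adm) (auto simp: permutations_of_set_def)
qed (auto simp: set_concat)

lemma lambda_complete_le: "lambda_complete i \<alpha> \<le> i * (\<alpha> + i) + \<alpha>"
  unfolding lambda_complete_def
proof (rule Least_le, intro exI conjI)
  show "complete_word i \<alpha> (concat (replicate i [1..<Suc (\<alpha> + i)]) @ [1..<Suc \<alpha>])"
    by (rule complete_word_power)
  show "length (concat (replicate i [1..<Suc (\<alpha> + i)]) @ [1..<Suc \<alpha>]) = i * (\<alpha> + i) + \<alpha>"
    by (simp add: length_concat map_replicate_const sum_list_replicate)
qed


section \<open>Asynchronous updates of monotone maps\<close>

lemma update_word_Nil [simp]: "update_word f [] x = x"
  and update_word_Cons [simp]: "update_word f (i # w) x = update_word f w (update_component f i x)"
  and update_word_append [simp]: "update_word f (v @ w) x = update_word f w (update_word f v x)"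
  by (simp_all add: update_word_def)

lemma update_component_fixed: "f x a = x a \<Longrightarrow> update_component f a x = x"
  by (simp add: update_component_def)

lemma update_word_fixed:
  "(\<And>a. a \<in> set w \<Longrightarrow> f x a = x a) \<Longrightarrow> update_word f w x = x"
  by (induction w) (auto simp: update_component_fixed)

lemma update_word_other: "a \<notin> set w \<Longrightarrow> update_word f w x a = x a"
  by (induction w arbitrary: x) (auto simp: update_component_def)

lemma update_word_mono:
  assumes "mono f" "x \<le> y"
  shows "update_word f w x \<le> update_word f w y"
  using assms(2)
proof (induction w arbitrary: x y)
  case (Cons a w)
  have "update_component f a x \<le> update_component f a y"
    using Cons.prems monoD[OF assms(1) Cons.prems]
    by (auto simp: update_component_def le_fun_def)
  then show ?case
    using Cons.IH by simp
qed simp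

text \<open>This is why loops are harmless: by monotonicity a component that has just risen or
  fallen can only be confirmed by its own influence.\<close>

lemma update_component_self:
  assumes "mono f"
  shows "f (update_component f a x) a = update_component f a x a"
proof -
  let ?y = "update_component f a x"
  have "f x \<le> f ?y" if "f x a"
    by (rule monoD[OF assms]) (use that in \<open>auto simp: update_component_def le_fun_def\<close>)
  moreover have "f ?y \<le> f x" if "\<not> f x a"
    by (rule monoD[OF assms]) (use that in \<open>auto simp: update_component_def le_fun_def\<close>)
  ultimately show ?thesis
    by (cases "f x a") (auto simp: update_component_def le_fun_def)
qed

text \<open>In such states updates within \<open>S\<close> only go up. Restricting to
  \<open>S\<close> leaves the components not yet treated unconstrained.\<close>

definition rising :: "((nat \<Rightarrow> bool) \<Rightarrow> nat \<Rightarrow> bool) \<Rightarrow> nat set \<Rightarrow> (nat \<Rightarrow> bool) \<Rightarrow> bool" where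
  "rising f S x \<longleftrightarrow> (\<forall>a\<in>S. x a \<le> f x a)"

text \<open>The update raises the state, hence also its image under \<open>f\<close>, so no
  component of \<open>S\<close> acquires a reason to fall.\<close>

lemma rising_update_component:
  assumes "mono f" "rising f S x" "a \<in> S"
  shows "rising f S (update_component f a x)" "x \<le> update_component f a x"
proof -
  show le: "x \<le> update_component f a x"
    using assms by (auto simp: rising_def update_component_def le_fun_def)
  show "rising f S (update_component f a x)"
    using monoD[OF assms(1) le] assms(2)
    by (auto simp: rising_def update_component_def le_fun_def)
qed

lemma rising_update_word:
  assumes "mono f" "rising f S x" "set w \<subseteq> S"
  shows "rising f S (update_word f w x)" "x \<le> update_word f w x"
proof -
  have "rising f S (update_word f w x) \<and> x \<le> update_word f w x"
    using assms(2,3)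
  proof (induction w arbitrary: x)
    case (Cons a w)
    then show ?case
      using rising_update_component[OF assms(1), of S x a] by (auto intro: order_trans)
  qed simp
  then show "rising f S (update_word f w x)" "x \<le> update_word f w x"
    by auto
qed

text \<open>Common letters preserve the order by monotonicity, and the extra letters of
  \<open>w\<close> only push the larger, rising trajectory further up.\<close>

lemma update_word_subseq_le:
  assumes "mono f" "subseq v w" "rising f S y" "set w \<subseteq> S" "x \<le> y"
  shows "update_word f v x \<le> update_word f w y"
  using assms(2-)
proof (induction arbitrary: x y rule: list_emb.induct)
  case (list_emb_Nil w)
  then show ?case
    using rising_update_word(2)[OF assms(1), of S y w] by auto
next
  case (list_emb_Cons v w a)
  then show ?case
    using rising_update_component[OF assms(1), of S y a] by (auto intro: order_trans)
next
  case (list_emb_Cons2 a b v w)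
  then show ?case
    using rising_update_component[OF assms(1), of S y b]
      update_word_mono[OF assms(1), of x y "[b]"] by auto
qed

text \<open>The extra updates cannot end below the result of \<open>v\<close> by the previous lemma.
  They cannot end above it either, since that result lies above \<open>x\<close> and is left
  unchanged by \<open>w\<close>.\<close>

lemma update_word_supersequence:
  assumes "mono f" "rising f S x" "subseq v w" "set w \<subseteq> S"
    and fixed: "\<And>a. a \<in> S \<Longrightarrow> f (update_word f v x) a = update_word f v x a"
  shows "update_word f w x = update_word f v x"
proof (rule antisym)
  let ?z = "update_word f v x"
  have "set v \<subseteq> S"
    using assms(3,4) by (meson subseq_singleton_left subseq_order.order_trans subset_iff)
  then have "x \<le> ?z"
    using rising_update_word assms by blast
  then have "update_word f w x \<le> update_word f w ?z"
    by (rule update_word_mono[OF assms(1)])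
  also have "\<dots> = ?z"
    using fixed assms(4) by (intro update_word_fixed) auto
  finally show "update_word f w x \<le> ?z" .
  show "?z \<le> update_word f w x"
    using update_word_subseq_le[OF assms(1,3,2,4)] by simp
qed

text \<open>Keep only the letters whose update changes the state. Along a rising trajectory each
  component changes at most once, so no kept letter repeats.\<close>

lemma rising_effective_subword:
  assumes "mono f" "rising f S x" "set w \<subseteq> S" "sorted_wrt P w"
  shows "\<exists>v. sorted_wrt P v \<and> distinct v \<and> set v \<subseteq> {a \<in> set w. \<not> x a \<and> update_word f w x a} \<and>
    update_word f v x = update_word f w x"
  using assms(2-)
proof (induction w arbitrary: x)
  case (Cons a w)
  let ?y = "update_component f a x"
  have y: "rising f S ?y" "x \<le> ?y"
    using rising_update_component[OF assms(1) Cons.prems(1)] Cons.prems(2) by auto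
  then obtain v where v: "sorted_wrt P v" "distinct v" "set v \<subseteq> {b \<in> set w. \<not> ?y b \<and> update_word f w ?y b}"
      "update_word f v ?y = update_word f w ?y"
    using Cons.IH[of ?y] Cons.prems by auto
  show ?case
  proof (cases "?y = x")
    case True
    then show ?thesis
      using v by (intro exI[of _ v]) auto
  next
    case False
    then have a: "\<not> x a" "?y a"
      using y(2) by (auto simp: update_component_def le_fun_def fun_upd_idem_iff)
    have "\<not> x b" if "b \<in> set v" for b
      using that v(3) y(2) by (auto simp: le_fun_def)
    moreover have "a \<notin> set v"
      using v(3) a by auto
    moreover have up: "update_word f w ?y a"
      using rising_update_word(2)[OF assms(1) y(1), of w] Cons.prems(2) a(2)
      by (auto simp: le_fun_def)
    ultimately have "sorted_wrt P (a # v) \<and> distinct (a # v) \<and>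
        set (a # v) \<subseteq> {b \<in> set (a # w). \<not> x b \<and> update_word f (a # w) x b} \<and>
        update_word f (a # v) x = update_word f (a # w) x"
      using v a up Cons.prems(3) by auto
    then show ?thesis ..
  qed
qed auto


section \<open>Triangular maps\<close>

text \<open>Up to loops, the dependencies among \<open>{1..\<alpha>}\<close> are acyclic and
  numbered topologically. All functions are allowed as arguments, to fit maps that are not confined
  to \<open>states\<close>.\<close>

definition triangular :: "nat \<Rightarrow> ((nat \<Rightarrow> bool) \<Rightarrow> nat \<Rightarrow> bool) \<Rightarrow> bool" where
  "triangular \<alpha> f \<longleftrightarrow> (\<forall>a b x v. 1 \<le> a \<longrightarrow> a < b \<longrightarrow> b \<le> \<alpha> \<longrightarrow> f (x(b := v)) a = f x a)"

text \<open>An update makes its own component stable by \<open>update_component_self\<close> and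
  does not affect the smaller ones, on account of triangularity.\<close>

lemma triangular_sweep:
  assumes "mono f" "triangular \<alpha> f" "k \<le> \<alpha>" "a \<in> {1..k}"
  shows "f (update_word f [1..<Suc k] x) a = update_word f [1..<Suc k] x a"
  using assms(3,4)
proof (induction k arbitrary: a)
  case (Suc k)
  let ?y = "update_word f [1..<Suc k] x"
  have eq: "update_word f [1..<Suc (Suc k)] x = update_component f (Suc k) ?y"
    by (simp add: upt_Suc_append)
  show ?case
  proof (cases "a = Suc k")
    case True
    then show ?thesis
      unfolding eq using update_component_self[OF assms(1)] by simp
  next
    case False
    then have "f ?y a = ?y a"
      using Suc by auto
    moreover have "f (?y(Suc k := v)) a = f ?y a" for v
      using False Suc.prems assms(2) by (simp add: triangular_def del: upt_Suc fun_upd_apply)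
    moreover have "update_component f (Suc k) ?y a = ?y a"
      using False by (simp add: update_component_def del: upt_Suc)
    ultimately show ?thesis
      unfolding eq by (metis update_component_def)
  qed
qed simp

text \<open>
  A component above \<open>\<alpha>\<close> is raised only after a sweep over \<open>{1..\<alpha>}\<close> has stabilized the components
  there; hence the components rise in an admissible order.
\<close>

lemma rising_fixing_word:
  assumes "mono f" "triangular \<alpha> f" "finite S" "{1..\<alpha>} \<subseteq> S" "rising f S x"
  shows "\<exists>v. admissible \<alpha> v \<and> distinct v \<and> set v \<subseteq> {a \<in> S. \<not> x a} \<and>
    (\<forall>a\<in>S. f (update_word f v x) a = update_word f v x a)"
  using assms(5)
proof (induction "card {a \<in> S. \<not> x a}" arbitrary: x rule: less_induct)
  case less
  let ?sweep = "[1..<Suc \<alpha>]"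
  have sw: "set ?sweep \<subseteq> S"
    using assms(4) by auto
  \<comment> \<open>The full sweep is thinned to the letters that really rise, since the word under
    construction must not repeat letters.\<close>
  obtain v where v: "sorted_wrt (<) v" "distinct v"
      "set v \<subseteq> {a \<in> set ?sweep. \<not> x a \<and> update_word f ?sweep x a}"
      "update_word f v x = update_word f ?sweep x"
    using rising_effective_subword[OF assms(1) less.prems sw sorted_wrt_upt] by blast
  define y where "y = update_word f v x"
  have y: "rising f S y" "x \<le> y"
    unfolding y_def v(4) using rising_update_word[OF assms(1) less.prems sw] by auto
  have adm: "admissible \<alpha> v"
    unfolding admissible_def
    using successively_if_sorted_wrt[OF v(1)] by (rule successively_mono) auto
  have vS: "set v \<subseteq> {a \<in> S. \<not> x a}"
    using v(3) sw by auto
  show ?case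
  proof (cases "\<forall>a\<in>S. f y a = y a")
    case True
    then show ?thesis
      using adm v(2) vS by (auto simp: y_def)
  next
    case False
    then obtain c where c: "c \<in> S" "f y c \<noteq> y c"
      by auto
    then have yc: "\<not> y c" "f y c"
      using y(1) by (auto simp: rising_def)
    have c\<alpha>: "c \<notin> {1..\<alpha>}"
      using triangular_sweep[OF assms(1,2) order_refl, of c x] c(2) by (auto simp: y_def v(4))
    define z where "z = update_component f c y"
    have z: "rising f S z" "y \<le> z"
      unfolding z_def using rising_update_component[OF assms(1) y(1) c(1)] by auto
    have zc: "z c"
      using yc by (simp add: z_def update_component_def)
    have xz: "x \<le> z" and xc: "\<not> x c"
      using y(2) z(2) yc(1) by (auto simp: le_fun_def)
    have "{a \<in> S. \<not> z a} \<subset> {a \<in> S. \<not> x a}"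
      using xz xc zc c(1) by (auto simp: le_fun_def)
    then have "card {a \<in> S. \<not> z a} < card {a \<in> S. \<not> x a}"
      using assms(3) by (intro psubset_card_mono) auto
    then obtain u where u: "admissible \<alpha> u" "distinct u" "set u \<subseteq> {a \<in> S. \<not> z a}"
        "\<forall>a\<in>S. f (update_word f u z) a = update_word f u z a"
      using less.hyps z(1) by blast
    \<comment> \<open>Components raised by \<open>v\<close> stay up, whereas \<open>u\<close> uses
      only components that are still down in \<open>z\<close>; so the parts of the word are
      disjoint.\<close>
    have "y a" if "a \<in> set v" for a
      using that v(3) by (auto simp: y_def v(4))
    then have dis: "set v \<inter> set u = {}" "c \<notin> set v" "c \<notin> set u"
      using u(3) z(2) yc zc by (auto simp: le_fun_def)
    \<comment> \<open>As \<open>c\<close> lies outside \<open>{1..\<alpha>}\<close>, it separates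
      \<open>v\<close> from \<open>u\<close>, and both junctions are unconstrained.\<close>
    have "admissible \<alpha> (v @ c # u)"
      using adm u(1) c\<alpha> by (auto simp: admissible_def successively_append_iff successively_Cons)
    moreover have "distinct (v @ c # u)"
      using v(2) u(2) dis by auto
    moreover have "set (v @ c # u) \<subseteq> {a \<in> S. \<not> x a}"
      using vS u(3) xz xc c(1) by (auto simp: le_fun_def)
    ultimately show ?thesis
      using u(4) by (intro exI[of _ "v @ c # u"]) (simp add: y_def[symmetric] z_def[symmetric])
  qed
qed


section \<open>Duality: conjugation by the complement of all components\<close>

definition negated :: "((nat \<Rightarrow> bool) \<Rightarrow> nat \<Rightarrow> bool) \<Rightarrow> (nat \<Rightarrow> bool) \<Rightarrow> nat \<Rightarrow> bool" where
  "negated f x a = (\<not> f (\<lambda>b. \<not> x b) a)"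

lemma mono_negated:
  assumes "mono f"
  shows "mono (negated f)"
proof (rule monoI)
  fix x y :: "nat \<Rightarrow> bool"
  assume "x \<le> y"
  then have "f (\<lambda>b. \<not> y b) \<le> f (\<lambda>b. \<not> x b)"
    by (intro monoD[OF assms]) (auto simp: le_fun_def)
  then show "negated f x \<le> negated f y"
    by (auto simp: negated_def le_fun_def)
qed

lemma triangular_negated:
  assumes "triangular \<alpha> f"
  shows "triangular \<alpha> (negated f)"
  unfolding triangular_def negated_def
proof (intro allI impI)
  fix a b :: nat and x :: "nat \<Rightarrow> bool" and v
  assume "1 \<le> a" "a < b" "b \<le> \<alpha>"
  then have "f ((\<lambda>c. \<not> x c)(b := \<not> v)) a = f (\<lambda>c. \<not> x c) a"
    using assms unfolding triangular_def by blast
  moreover have "(\<lambda>c. \<not> x c)(b := \<not> v) = (\<lambda>c. \<not> (x(b := v)) c)"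
    by auto
  ultimately show "(\<not> f (\<lambda>c. \<not> (x(b := v)) c) a) = (\<not> f (\<lambda>c. \<not> x c) a)"
    by simp
qed

lemma update_word_negated:
  "update_word (negated f) w (\<lambda>b. \<not> x b) = (\<lambda>b. \<not> update_word f w x b)"
proof (induction w arbitrary: x)
  case (Cons a w)
  have "update_component (negated f) a (\<lambda>b. \<not> x b) = (\<lambda>b. \<not> update_component f a x b)"
    by (auto simp: update_component_def negated_def)
  then show ?case
    using Cons.IH by simp
qed simp

text \<open>The stabilizing word \<open>v\<close> depends on \<open>f\<close> and \<open>x\<close>,
  but being admissible and free of repetitions it is contained in every complete word, and the
  additional letters do no harm.\<close>

lemma complete_word_fixes_rising:
  assumes "mono f" "triangular \<alpha> f" "complete_word i \<alpha> w" "rising f {1..\<alpha> + i} x"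
    and "a \<in> {1..\<alpha> + i}"
  shows "f (update_word f w x) a = update_word f w x a"
proof -
  have "finite {1..\<alpha> + i}" "{1..\<alpha>} \<subseteq> {1..\<alpha> + i}"
    by auto
  then obtain v where v: "admissible \<alpha> v" "distinct v" "set v \<subseteq> {1..\<alpha> + i}"
      "\<forall>a\<in>{1..\<alpha> + i}. f (update_word f v x) a = update_word f v x a"
    using rising_fixing_word[OF assms(1,2) _ _ assms(4)] by blast
  have "update_word f w x = update_word f v x"
    using assms(3) v(4) complete_word_subseq[OF assms(3) v(1-3)]
    by (intro update_word_supersequence[OF assms(1,4)]) (auto simp: complete_word_def)
  then show ?thesis
    using v(4) assms(5) by simp
qed

text \<open>If \<open>c\<close> changes, it rises and the state is rising on
  \<open>insert c S\<close>. Then \<open>w\<close> stabilizes \<open>S\<close> without touching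
  \<open>c\<close>.\<close>

lemma complete_word_fixes_next_rising:
  fixes \<alpha> i :: nat
  defines "S \<equiv> {1..\<alpha> + i}" and "c \<equiv> \<alpha> + Suc i"
  assumes "mono f" "triangular \<alpha> f" "complete_word i \<alpha> w"
    and fixed: "\<And>a. a \<in> S \<Longrightarrow> f x a = x a" and le: "x c \<le> f x c"
    and "a \<in> insert c S"
  shows "f (update_word f (c # w) x) a = update_word f (c # w) x a"
proof (cases "f x c = x c")
  case True
  then have "update_word f (c # w) x = x"
    using assms by (intro update_word_fixed) (auto simp: complete_word_def)
  then show ?thesis
    using True assms by auto
next
  case False
  define y where "y = update_component f c x"
  define z where "z = update_word f w y"
  have "rising f (insert c S) x"
    using fixed le by (auto simp: rising_def)
  then have y: "rising f (insert c S) y"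
    using rising_update_component[OF assms(3)] by (simp add: y_def)
  have w: "set w \<subseteq> S"
    using assms(5) by (simp add: complete_word_def S_def)
  have z: "rising f (insert c S) z"
    unfolding z_def using rising_update_word[OF assms(3) y] w by blast
  have "c \<notin> set w"
    using w by (auto simp: S_def c_def)
  then have "z c"
    using False le by (simp add: z_def y_def update_word_other update_component_def)
  moreover have "f z a = z a" if "a \<in> S"
    using complete_word_fixes_rising[OF assms(3-5), of y a] y that
    by (simp add: z_def S_def rising_def)
  \<comment> \<open>At \<open>c\<close> itself, \<open>z c\<close> is true and \<open>z\<close> is
    rising there, so \<open>f z c\<close> is true as well.\<close>
  ultimately have "f z a = z a"
    using z \<open>a \<in> insert c S\<close> by (auto simp: rising_def)
  then show ?thesis
    by (simp add: z_def y_def)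
qed

text \<open>If \<open>c\<close> falls, pass to \<open>negated f\<close> and the complemented state,
  where \<open>c\<close> rises. The same word serves both cases, as completeness does not involve
  \<open>f\<close>.\<close>

lemma complete_word_fixes_next:
  fixes \<alpha> i :: nat
  defines "S \<equiv> {1..\<alpha> + i}" and "c \<equiv> \<alpha> + Suc i"
  assumes "mono f" "triangular \<alpha> f" "complete_word i \<alpha> w"
    and fixed: "\<And>a. a \<in> S \<Longrightarrow> f x a = x a"
    and "a \<in> insert c S"
  shows "f (update_word f (c # w) x) a = update_word f (c # w) x a"
proof (cases "x c \<le> f x c")
  case True
  then show ?thesis
    using complete_word_fixes_next_rising[OF assms(3-5)] assms(6-) unfolding S_def c_def by blast
next
  case False
  let ?x = "\<lambda>b. \<not> x b"
  have "negated f ?x b = ?x b" if "b \<in> {1..\<alpha> + i}" for b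
    using that fixed by (simp add: negated_def S_def)
  moreover have "?x (\<alpha> + Suc i) \<le> negated f ?x (\<alpha> + Suc i)"
    using False by (simp add: negated_def c_def)
  ultimately have "negated f (update_word (negated f) (c # w) ?x) a =
      update_word (negated f) (c # w) ?x a"
    using complete_word_fixes_next_rising[OF mono_negated[OF assms(3)]
        triangular_negated[OF assms(4)] assms(5), of ?x a] assms(7)
    unfolding S_def c_def by blast
  then show ?thesis
    unfolding update_word_negated by (simp add: negated_def)
qed

text \<open>The letter \<open>\<alpha> + Suc i\<close> disturbs the stable components
  \<open>{1..\<alpha> + i}\<close>, and \<open>W i\<close> repairs them. The repair word ranges over
  the letters before the new one, whence the index shift in the final sum.\<close>

fun fixing_word :: "nat \<Rightarrow> (nat \<Rightarrow> nat list) \<Rightarrow> nat \<Rightarrow> nat list" where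
  "fixing_word \<alpha> W 0 = [1..<Suc \<alpha>]"
| "fixing_word \<alpha> W (Suc i) = fixing_word \<alpha> W i @ (\<alpha> + Suc i) # W i"

lemma fixing_word_fixes:
  assumes "mono f" "triangular \<alpha> f" "\<And>i. complete_word i \<alpha> (W i)" "a \<in> {1..\<alpha> + i}"
  shows "f (update_word f (fixing_word \<alpha> W i) x) a = update_word f (fixing_word \<alpha> W i) x a"
  using assms(4)
proof (induction i arbitrary: a)
  case 0
  then show ?case
    using triangular_sweep[OF assms(1,2) order_refl, of a x] by simp
next
  case (Suc i)
  let ?y = "update_word f (fixing_word \<alpha> W i) x"
  have "a \<in> insert (\<alpha> + Suc i) {1..\<alpha> + i}"
    using Suc.prems by auto
  with complete_word_fixes_next[OF assms(1-3) Suc.IH this]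
  show ?case
    by simp
qed

lemma set_fixing_word:
  assumes "\<And>i. complete_word i \<alpha> (W i)"
  shows "set (fixing_word \<alpha> W i) \<subseteq> {1..\<alpha> + i}"
proof (induction i)
  case (Suc i)
  have "set (W i) \<subseteq> {1..\<alpha> + i}"
    using assms[of i] by (simp add: complete_word_def)
  then show ?case
    using Suc by auto
qed auto

lemma length_fixing_word: "length (fixing_word \<alpha> W i) = \<alpha> + i + (\<Sum>j<i. length (W j))"
  by (induction i) auto


section \<open>Networks with a given feedback vertex set\<close>

text \<open>
  The network read through the renaming \<open>\<sigma>\<close> of its components. Restricting the argument makes it
  a monotone map on all functions and not only on the states.
\<close>

definition renamed ::
    "nat \<Rightarrow> (nat \<Rightarrow> nat) \<Rightarrow> ((nat \<Rightarrow> bool) \<Rightarrow> nat \<Rightarrow> bool) \<Rightarrow> (nat \<Rightarrow> bool) \<Rightarrow> nat \<Rightarrow> bool" where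
  "renamed n \<sigma> f y a = f (restrict (y \<circ> inv \<sigma>) {1..n}) (\<sigma> a)"

lemma restrict_in_states: "restrict y {1..n} \<in> states n"
  by (simp add: states_def)

lemma mono_renamed:
  assumes "monotone_network n f"
  shows "mono (renamed n \<sigma> f)"
proof (rule monoI)
  fix x y :: "nat \<Rightarrow> bool"
  assume "x \<le> y"
  then have "restrict (x \<circ> inv \<sigma>) {1..n} \<le> restrict (y \<circ> inv \<sigma>) {1..n}"
    by (auto simp: le_fun_def)
  then have "f (restrict (x \<circ> inv \<sigma>) {1..n}) \<le> f (restrict (y \<circ> inv \<sigma>) {1..n})"
    using assms restrict_in_states mono_onD[of "states n" f] unfolding monotone_network_def by blast
  then show "renamed n \<sigma> f x \<le> renamed n \<sigma> f y"
    by (simp add: renamed_def le_fun_def)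
qed

text \<open>Changing \<open>b\<close> in \<open>x\<close> changes at most the component
  \<open>\<sigma> b\<close> of the state passed to \<open>f\<close>; an effect on
  \<open>\<sigma> a\<close> would witness an arc that is excluded.\<close>

lemma triangular_renamed:
  assumes \<sigma>: "\<sigma> permutes {1..n}" and "\<alpha> \<le> n"
    and no_arc: "\<And>a b. 1 \<le> a \<Longrightarrow> a < b \<Longrightarrow> b \<le> \<alpha> \<Longrightarrow> (\<sigma> b, \<sigma> a) \<notin> parcs (interaction_graph n f)"
  shows "triangular \<alpha> (renamed n \<sigma> f)"
  unfolding triangular_def
proof (intro allI impI)
  fix a b :: nat and x :: "nat \<Rightarrow> bool" and v
  assume ab: "1 \<le> a" "a < b" "b \<le> \<alpha>"
  define y where "y = restrict (x \<circ> inv \<sigma>) {1..n}"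
  define z where "z = restrict (x(b := v) \<circ> inv \<sigma>) {1..n}"
  have \<sigma>ab: "\<sigma> a \<in> {1..n}" "\<sigma> b \<in> {1..n}"
    using ab \<open>\<alpha> \<le> n\<close> permutes_in_image[OF \<sigma>] by auto
  have eq: "y k = z k" if "k \<noteq> \<sigma> b" for k
    using that permutes_inverses[OF \<sigma>] by (auto simp: y_def z_def)
  \<comment> \<open>Arcs are witnessed by states that really differ at \<open>\<sigma> b\<close>, so
    the case where \<open>v\<close> is the old value is treated apart.\<close>
  have "y = z" if "y (\<sigma> b) = z (\<sigma> b)"
  proof
    show "y k = z k" for k
      using eq that by (cases "k = \<sigma> b") auto
  qed
  moreover have "y \<in> states n" "z \<in> states n"
    unfolding y_def z_def by (rule restrict_in_states)+
  then have "y (\<sigma> b) \<noteq> z (\<sigma> b) \<Longrightarrow> f y (\<sigma> a) \<noteq> f z (\<sigma> a) \<Longrightarrow>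
      (\<sigma> b, \<sigma> a) \<in> parcs (interaction_graph n f)"
    using \<sigma>ab eq unfolding interaction_graph_def by (simp, blast)
  ultimately have "f z (\<sigma> a) = f y (\<sigma> a)"
    using no_arc[OF ab] by blast
  then show "renamed n \<sigma> f (x(b := v)) a = renamed n \<sigma> f x a"
    by (simp add: renamed_def y_def z_def)
qed

text \<open>The map from \<open>y\<close> to \<open>restrict (y \<circ> inv \<sigma>) {1..n}\<close>
  intertwines each renamed update with the corresponding update of \<open>f\<close>.\<close>

lemma update_word_renamed:
  assumes \<sigma>: "\<sigma> permutes {1..n}" and "set w \<subseteq> {1..n}"
  shows "update_word f (map \<sigma> w) (restrict (y \<circ> inv \<sigma>) {1..n}) =
    restrict (update_word (renamed n \<sigma> f) w y \<circ> inv \<sigma>) {1..n}"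
  using assms(2)
proof (induction w arbitrary: y)
  case (Cons a w)
  have "\<sigma> a \<in> {1..n}"
    using Cons.prems permutes_in_image[OF \<sigma>] by auto
  then have "update_component f (\<sigma> a) (restrict (y \<circ> inv \<sigma>) {1..n}) =
      restrict (update_component (renamed n \<sigma> f) a y \<circ> inv \<sigma>) {1..n}"
    using permutes_inverses[OF \<sigma>]
    by (auto simp: update_component_def renamed_def fun_eq_iff)
  moreover have "set w \<subseteq> {1..n}"
    using Cons.prems by simp
  ultimately show ?case
    by (simp only: list.map update_word_Cons Cons.IH)
qed simp

lemma fixes_network_renamed:
  assumes \<sigma>: "\<sigma> permutes {1..n}" and "network n f" and "set w \<subseteq> {1..n}"
    and fixed: "\<And>y a. a \<in> {1..n} \<Longrightarrow>
      renamed n \<sigma> f (update_word (renamed n \<sigma> f) w y) a = update_word (renamed n \<sigma> f) w y a"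
  shows "fixes_network n f (map \<sigma> w)"
  unfolding fixes_network_def
proof (intro ballI ext)
  fix x k
  assume x: "x \<in> states n"
  \<comment> \<open>The function \<open>x \<circ> \<sigma>\<close> is a preimage of the state
    \<open>x\<close> under this map.\<close>
  define y where "y = update_word (renamed n \<sigma> f) w (x \<circ> \<sigma>)"
  define z where "z = update_word f (map \<sigma> w) x"
  have "x = restrict (x \<circ> \<sigma> \<circ> inv \<sigma>) {1..n}"
    using x permutes_inverses[OF \<sigma>] by (auto simp: states_def PiE_def extensional_def fun_eq_iff)
  then have z: "z = restrict (y \<circ> inv \<sigma>) {1..n}"
    using update_word_renamed[OF \<sigma> assms(3), of f "x \<circ> \<sigma>"] by (simp add: z_def y_def)
  have "f z k = z k"
  proof (cases "k \<in> {1..n}")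
    case True
    then have "inv \<sigma> k \<in> {1..n}" "\<sigma> (inv \<sigma> k) = k"
      using permutes_in_image[OF permutes_inv[OF \<sigma>]] permutes_inverses[OF \<sigma>] by auto
    then show ?thesis
      using fixed[of "inv \<sigma> k" "x \<circ> \<sigma>"] True by (simp add: y_def[symmetric] renamed_def z)
  next
    case False
    \<comment> \<open>Outside \<open>{1..n}\<close> both states take the default value
      \<open>undefined\<close>.\<close>
    moreover have "z \<in> states n" "f z \<in> states n"
      using assms(2) restrict_in_states by (auto simp: z network_def)
    ultimately show ?thesis
      by (auto simp: states_def PiE_def extensional_def)
  qed
  then show "f (update_word f (map \<sigma> w) x) k = update_word f (map \<sigma> w) x k"
    by (simp add: z_def)
qed

section \<open>Minimum witnesses and the two bounds\<close>

lemma ex_minimum_feedback_vertex_set: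
  "\<exists>I. one_feedback_vertex_set G I \<and> card I = one_transversal_number G"
proof -
  have "\<exists>I. one_feedback_vertex_set G I \<and> card I = card (pverts G)"
    using one_feedback_vertex_set_pverts by blast
  then show ?thesis
    unfolding one_transversal_number_def by (rule LeastI)
qed

lemma ex_minimum_complete_word: "\<exists>w. complete_word i \<alpha> w \<and> length w = lambda_complete i \<alpha>"
proof -
  obtain w where "complete_word i \<alpha> w"
    using ex_complete_word by blast
  then have "\<exists>v. complete_word i \<alpha> v \<and> length v = length w"
    by blast
  then show ?thesis
    unfolding lambda_complete_def by (rule LeastI)
qed

text \<open>The renaming and the word are chosen from \<open>G\<close> alone. They serve all
  networks at once, because every interaction graph considered has only arcs of
  \<open>G\<close>.\<close>

lemma lambda_M_le_if_feedback_vertex_set: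
  assumes "pair_wf_digraph G" "pverts G = {1..n}" "one_feedback_vertex_set G I"
  shows "lambda_M n G \<le> enat (n + (\<Sum>j<card I. lambda_complete j (n - card I)))"
proof -
  define \<alpha> where "\<alpha> = n - card I"
  have "card I \<le> n"
    using assms(2,3) card_mono[of "{1..n}" I] by (auto simp: one_feedback_vertex_set_def)
  then have n: "\<alpha> + card I = n"
    by (simp add: \<alpha>_def)
  obtain \<sigma> where \<sigma>: "\<sigma> permutes {1..n}"
    and no_arc: "\<And>a b. 1 \<le> a \<Longrightarrow> a < b \<Longrightarrow> b \<le> \<alpha> \<Longrightarrow> (\<sigma> b, \<sigma> a) \<notin> parcs G"
    using feedback_vertex_set_ordering[OF assms] unfolding \<alpha>_def by blast
  have "\<forall>i. \<exists>w. complete_word i \<alpha> w \<and> length w = lambda_complete i \<alpha>"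
    using ex_minimum_complete_word by blast
  from choice[OF this] obtain W
    where W: "\<And>i. complete_word i \<alpha> (W i)" "\<And>i. length (W i) = lambda_complete i \<alpha>"
    by blast
  define w where "w = fixing_word \<alpha> W (card I)"
  have w: "set w \<subseteq> {1..n}"
    using set_fixing_word[OF W(1), of "card I"] n by (simp add: w_def)
  then have "set (map \<sigma> w) \<subseteq> {1..n}"
    using permutes_in_image[OF \<sigma>] by auto
  moreover have "fixes_network n f (map \<sigma> w)"
    if f: "monotone_network n f" "subgraph (with_proj (interaction_graph n f)) (with_proj G)" for f
  proof (rule fixes_network_renamed[OF \<sigma> _ w])
    show "network n f"
      using f(1) by (simp add: monotone_network_def)
    have "parcs (interaction_graph n f) \<subseteq> parcs G"
      using f(2) by (simp add: subgraph_def)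
    then have "triangular \<alpha> (renamed n \<sigma> f)"
      using no_arc n by (intro triangular_renamed[OF \<sigma>]) auto
    then show "renamed n \<sigma> f (update_word (renamed n \<sigma> f) w y) a =
        update_word (renamed n \<sigma> f) w y a" if "a \<in> {1..n}" for y a
      using fixing_word_fixes[OF mono_renamed[OF f(1)] _ W(1)] that n by (simp add: w_def)
  qed
  ultimately have "lambda_M n G \<le> enat (length (map \<sigma> w))"
    unfolding lambda_M_def by (intro INF_lower) blast
  also have "length (map \<sigma> w) = n + (\<Sum>j<card I. lambda_complete j \<alpha>)"
    using n by (simp add: w_def length_fixing_word W(2))
  finally show ?thesis
    by (simp add: \<alpha>_def)
qed

text \<open>The \<open>j\<close>-th summand is at most \<open>(j + 2) * n\<close>, and the numbers
  \<open>j + 2\<close> for \<open>j < \<tau>\<close> add up to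
  \<open>\<tau> * (\<tau> + 3) / 2\<close>.\<close>

lemma sum_lambda_complete_le:
  assumes "\<tau> \<le> n"
  shows "real (\<Sum>j<\<tau>. lambda_complete j (n - \<tau>)) \<le> ((real \<tau>)\<^sup>2 / 2 + 3 * real \<tau> / 2) * real n"
proof -
  have "lambda_complete j (n - \<tau>) \<le> (j + 2) * n" if "j < \<tau>" for j
  proof -
    have "lambda_complete j (n - \<tau>) \<le> j * (n - \<tau> + j) + (n - \<tau>)"
      by (rule lambda_complete_le)
    \<comment> \<open>The coarse term \<open>2 * n\<close> makes the sum agree exactly with the
      polynomial claimed.\<close>
    also have "\<dots> \<le> j * n + 2 * n"
      using that assms by (intro add_mono mult_le_mono) auto
    finally show ?thesis
      by (simp add: algebra_simps)
  qed
  then have "(\<Sum>j<\<tau>. lambda_complete j (n - \<tau>)) \<le> (\<Sum>j<\<tau>. (j + 2) * n)"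
    by (intro sum_mono) auto
  then have "real (\<Sum>j<\<tau>. lambda_complete j (n - \<tau>)) \<le> real (\<Sum>j<\<tau>. (j + 2) * n)"
    by (rule of_nat_mono)
  also have "\<dots> = ((real \<tau>)\<^sup>2 / 2 + 3 * real \<tau> / 2) * real n"
    by (induction \<tau>) (auto simp: field_simps power2_eq_square)
  finally show ?thesis .
qed

theorem theorem13:
  fixes n \<tau> :: nat and G :: "nat pair_pre_digraph"
  assumes "pair_wf_digraph G"
    and "pverts G = {1..n}"
    and "\<tau> = one_transversal_number G"
  shows "lambda_M n G \<le> enat (n + (\<Sum>i = 1..\<tau>. lambda_complete (i - 1) (n - \<tau>)))
    \<and> real (n + (\<Sum>i = 1..\<tau>. lambda_complete (i - 1) (n - \<tau>)))
        \<le> ((real \<tau>)\<^sup>2 / 2 + 3 * real \<tau> / 2 + 1) * real n"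
proof -
  obtain I where I: "one_feedback_vertex_set G I" "card I = \<tau>"
    using ex_minimum_feedback_vertex_set assms(3) by blast
  have "\<tau> \<le> n"
    using I assms(2) card_mono[of "{1..n}" I] by (auto simp: one_feedback_vertex_set_def)
  have "(\<Sum>i = 1..\<tau>. lambda_complete (i - 1) (n - \<tau>)) =
      (\<Sum>j<\<tau>. lambda_complete j (n - \<tau>))"
    by (simp add: sum.atLeast1_atMost_eq)
  moreover have "real (n + (\<Sum>j<\<tau>. lambda_complete j (n - \<tau>)))
      \<le> ((real \<tau>)\<^sup>2 / 2 + 3 * real \<tau> / 2 + 1) * real n"
    using sum_lambda_complete_le[OF \<open>\<tau> \<le> n\<close>] unfolding of_nat_add distrib_right by linarith
  ultimately show ?thesis
    using lambda_M_le_if_feedback_vertex_set[OF assms(1,2) I(1)] by (simp only: I(2))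
qed

end
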